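(* Let $A$ be a bounded operator in $L^2(\mathbb{R}^n)$. For all $X$ and $Z$ in $\mathbb{R}^{2n}$, $$\frac{\langle A\Psi_{X+Z},\Psi_{X-Z}\rangle}{\langle\Psi_{X+Z},\Psi_{X-Z}\rangle}=\Big\langle e^{-\Phi_S(Z)}Ae^{\Phi_S(Z)}\Psi_X,\Psi_X\Big\rangle .$$
   Context: Here $\langle f,g\rangle=\int_{\mathbb{R}^n} f(u)\overline{g(u)}\,du$ is the $L^2(\mathbb{R}^n)$ inner product. For $X=(x,\xi)\in\mathbb{R}^{2n}$ (with $x,\xi\in\mathbb{R}^n$), the coherent state $\Psi_X\in L^2(\mathbb{R}^n)$ is $$\Psi_{x,\xi}(u)=\pi^{-n/4}e^{-\frac12|u-x|^2+iu\cdot\xi-\frac i2 x\cdot\xi}.$$ These satisfy $\langle\Psi_X,\Psi_Z\rangle=e^{-\frac{|X-Z|^2}{4}+\frac i2\sigma(X,Z)}$, where $\sigma((x,\xi),(y,\eta))=y\cdot\xi-x\cdot\eta$ (so the denominator never vanishes). For $Z=(z,\zeta)\in\mathbb{R}^{2n}$, $\Phi_S(Z)$ is the differential operator $$\Phi_S(Z)=\sum_{j=1}^n\left(z_ju_j+\zeta_j\frac1i\frac{\partial}{\partial u_j}\right),$$ which is symmetric on $\mathcal{S}(\mathbb{R}^n)$. The operators $e^{\pm\Phi_S(Z)}$ are unbounded in $L^2(\mathbb{R}^n)$, but their action on coherent states is well defined: $e^{\pm\Phi_S(Z)}\Psi_X=\sum_{m\ge0}\frac{(\pm1)^m}{m!}\Phi_S(Z)^m\Psi_X$,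 a convergent series in $L^2(\mathbb{R}^n)$. Since $\Phi_S(Z)$ is symmetric, the right-hand side of the claim is understood as $$\Big\langle e^{-\Phi_S(Z)}Ae^{\Phi_S(Z)}\Psi_X,\Psi_X\Big\rangle:=\Big\langle A\,e^{\Phi_S(Z)}\Psi_X,\;e^{-\Phi_S(Z)}\Psi_X\Big\rangle .$$ *)

theory Defs
  imports "HOL-Analysis.Analysis"
begin

section \<open>The Hilbert space of square integrable functions\<close>

text \<open>
  Representatives are Borel measurable. This gives the usual \<open>L\<^sup>2\<close>, as every Lebesgue
  measurable function agrees almost everywhere with a Borel measurable one.
\<close>

definition square_integrable :: "('a::euclidean_space \<Rightarrow> complex) \<Rightarrow> bool" where
  "square_integrable f \<longleftrightarrow>
     f \<in> borel_measurable lborel \<and> integrable lborel (\<lambda>u. (cmod (f u))\<^sup>2)"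

lemma square_integrable_0 [simp]: "square_integrable (\<lambda>u. 0)"
  by (simp add: square_integrable_def)

lemma square_integrable_mult_cnj:
  assumes "square_integrable f" "square_integrable g"
  shows "integrable lborel (\<lambda>u. f u * cnj (g u))"
proof (rule Bochner_Integration.integrable_bound)
  show "integrable lborel (\<lambda>u. (cmod (f u))\<^sup>2 + (cmod (g u))\<^sup>2)"
    using assms by (simp add: square_integrable_def)
  have [measurable]: "f \<in> borel_measurable borel" "g \<in> borel_measurable borel"
    using assms by (auto simp: square_integrable_def)
  show "(\<lambda>u. f u * cnj (g u)) \<in> borel_measurable lborel"
    by (intro borel_measurable_times borel_measurable_continuous_on[of cnj, unfolded o_def])
       (auto intro: continuous_intros)
  have "cmod a * cmod b \<le> (cmod a)\<^sup>2 + (cmod b)\<^sup>2" for a b :: complex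
    using sum_squares_bound[of "cmod a" "cmod b"] mult_nonneg_nonneg[of "cmod a" "cmod b"]
      norm_ge_zero[of a] norm_ge_zero[of b] by linarith
  then show "AE u in lborel. norm (f u * cnj (g u)) \<le> norm ((cmod (f u))\<^sup>2 + (cmod (g u))\<^sup>2)"
    by (simp add: norm_mult)
qed

lemma square_integrable_add:
  assumes "square_integrable f" "square_integrable g"
  shows "square_integrable (\<lambda>u. f u + g u)"
  unfolding square_integrable_def
proof
  have [measurable]: "f \<in> borel_measurable borel" "g \<in> borel_measurable borel"
    using assms by (auto simp: square_integrable_def)
  show "(\<lambda>u. f u + g u) \<in> borel_measurable lborel" by simp
  show "integrable lborel (\<lambda>u. (cmod (f u + g u))\<^sup>2)"
  proof (rule Bochner_Integration.integrable_bound)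
    show "integrable lborel (\<lambda>u. 2 * (cmod (f u))\<^sup>2 + 2 * (cmod (g u))\<^sup>2)"
      using assms by (simp add: square_integrable_def)
    have "(cmod (a + b))\<^sup>2 \<le> 2 * (cmod a)\<^sup>2 + 2 * (cmod b)\<^sup>2" for a b
    proof -
      have "(cmod (a + b))\<^sup>2 \<le> (cmod a + cmod b)\<^sup>2"
        by (simp add: norm_triangle_ineq power_mono)
      also have "\<dots> \<le> 2 * (cmod a)\<^sup>2 + 2 * (cmod b)\<^sup>2"
        using sum_squares_bound[of "cmod a" "cmod b"] by (simp add: power2_sum)
      finally show ?thesis .
    qed
    then show "AE u in lborel. norm ((cmod (f u + g u))\<^sup>2)
        \<le> norm (2 * (cmod (f u))\<^sup>2 + 2 * (cmod (g u))\<^sup>2)"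
      by simp
  qed simp
qed

lemma square_integrable_scale:
  "square_integrable f \<Longrightarrow> square_integrable (\<lambda>u. c * f u)"
  by (auto simp: square_integrable_def norm_mult power_mult_distrib intro!: borel_measurable_times)

lemma square_integrable_minus:
  "square_integrable f \<Longrightarrow> square_integrable (\<lambda>u. - f u)"
  using square_integrable_scale[of f "-1"] by simp

definition L2_rel :: "('a::euclidean_space \<Rightarrow> complex) \<Rightarrow> ('a \<Rightarrow> complex) \<Rightarrow> bool" where
  "L2_rel f g \<longleftrightarrow>
     square_integrable f \<and> square_integrable g \<and> (AE u in lborel. f u = g u)"

quotient_type (overloaded) 'a L2 = "'a::euclidean_space \<Rightarrow> complex" / partial: L2_rel
proof (rule part_equivpI)
  show "\<exists>f. L2_rel f f" by (rule exI[of _ "\<lambda>_. 0"]) (simp add: L2_rel_def)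
  show "symp L2_rel" by (auto simp: L2_rel_def symp_def)
  show "transp L2_rel" by (auto simp: L2_rel_def transp_def elim: AE_mp)
qed

text \<open>The class of a function; functions that are not square integrable are sent to \<open>0\<close>.\<close>

lift_definition L2_of :: "('a::euclidean_space \<Rightarrow> complex) \<Rightarrow> 'a L2" is
  "\<lambda>f. if square_integrable f then f else (\<lambda>_. 0)"
  by (simp add: L2_rel_def)

lift_definition L2_inner :: "'a::euclidean_space L2 \<Rightarrow> 'a L2 \<Rightarrow> complex" is
  "\<lambda>f g. integral\<^sup>L lborel (\<lambda>u. f u * cnj (g u))"
  unfolding L2_rel_def
  by (intro integral_cong_AE borel_measurable_integrable square_integrable_mult_cnj) auto

lift_definition L2_cscale :: "complex \<Rightarrow> 'a::euclidean_space L2 \<Rightarrow> 'a L2" is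
  "\<lambda>c f u. c * f u"
  by (auto simp: L2_rel_def square_integrable_scale)

instantiation L2 :: (euclidean_space) real_vector
begin

lift_definition zero_L2 :: "'a L2" is "\<lambda>_. 0"
  by (simp add: L2_rel_def)

lift_definition plus_L2 :: "'a L2 \<Rightarrow> 'a L2 \<Rightarrow> 'a L2" is "\<lambda>f g u. f u + g u"
  unfolding L2_rel_def by (auto simp: square_integrable_add elim: AE_mp)

lift_definition uminus_L2 :: "'a L2 \<Rightarrow> 'a L2" is "\<lambda>f u. - f u"
  unfolding L2_rel_def by (auto simp: square_integrable_minus)

definition minus_L2 :: "'a L2 \<Rightarrow> 'a L2 \<Rightarrow> 'a L2" where
  "minus_L2 f g = f + (- g)"

definition scaleR_L2 :: "real \<Rightarrow> 'a L2 \<Rightarrow> 'a L2" where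
  "scaleR_L2 r f = L2_cscale (complex_of_real r) f"

instance
proof
  fix f g h :: "'a L2" and r s :: real
  show "f + g + h = f + (g + h)"
    by transfer (auto simp: L2_rel_def square_integrable_add add.assoc)
  show "f + g = g + f"
    by transfer (auto simp: L2_rel_def square_integrable_add add.commute)
  show "0 + f = f" by transfer (auto simp: L2_rel_def)
  show "- f + f = 0" by transfer (auto simp: L2_rel_def)
  show "f - g = f + - g" by (fact minus_L2_def)
  show "r *\<^sub>R (f + g) = r *\<^sub>R f + r *\<^sub>R g" unfolding scaleR_L2_def
    by transfer (auto simp: L2_rel_def square_integrable_add square_integrable_scale distrib_left)
  show "(r + s) *\<^sub>R f = r *\<^sub>R f + s *\<^sub>R f" unfolding scaleR_L2_def
    by transfer (auto simp: L2_rel_def square_integrable_add square_integrable_scale distrib_right)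
  show "r *\<^sub>R s *\<^sub>R f = (r * s) *\<^sub>R f" unfolding scaleR_L2_def
    by transfer (auto simp: L2_rel_def square_integrable_scale mult.assoc)
  show "1 *\<^sub>R f = f" unfolding scaleR_L2_def
    by transfer (auto simp: L2_rel_def)
qed

end

instantiation L2 :: (euclidean_space) real_inner
begin

definition inner_L2 :: "'a L2 \<Rightarrow> 'a L2 \<Rightarrow> real" where
  "inner_L2 f g = Re (L2_inner f g)"

definition norm_L2 :: "'a L2 \<Rightarrow> real" where
  "norm_L2 f = sqrt (Re (L2_inner f f))"

definition dist_L2 :: "'a L2 \<Rightarrow> 'a L2 \<Rightarrow> real" where
  "dist_L2 f g = norm (f - g)"

definition sgn_L2 :: "'a L2 \<Rightarrow> 'a L2" where
  "sgn_L2 f = f /\<^sub>R norm f"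

definition uniformity_L2 :: "('a L2 \<times> 'a L2) filter" where
  "uniformity_L2 = (INF e\<in>{0<..}. principal {(x, y). dist x y < e})"

definition open_L2 :: "'a L2 set \<Rightarrow> bool" where
  "open_L2 U = (\<forall>x\<in>U. eventually (\<lambda>(x', y). x' = x \<longrightarrow> y \<in> U) uniformity)"

instance
proof
  fix f g h :: "'a L2" and r :: real
  show "dist f g = norm (f - g)" by (fact dist_L2_def)
  show "sgn f = f /\<^sub>R norm f" by (fact sgn_L2_def)
  show "(uniformity :: ('a L2 \<times> 'a L2) filter) =
      (INF e\<in>{0<..}. principal {(x, y). dist x y < e})"
    by (fact uniformity_L2_def)
  show "open U = (\<forall>x\<in>U. \<forall>\<^sub>F (x', y) in uniformity. x' = x \<longrightarrow> y \<in> U)"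
    for U :: "'a L2 set"
    by (fact open_L2_def)
  show "norm f = sqrt (inner f f)" by (simp add: norm_L2_def inner_L2_def)
  show "inner f g = inner g f" unfolding inner_L2_def
  proof transfer
    fix f g :: "'a \<Rightarrow> complex"
    assume "L2_rel f f" "L2_rel g g"
    then have fg: "integrable lborel (\<lambda>u. f u * cnj (g u))"
      by (simp add: L2_rel_def square_integrable_mult_cnj)
    have "cnj (integral\<^sup>L lborel (\<lambda>u. f u * cnj (g u)))
        = integral\<^sup>L lborel (\<lambda>u. cnj (f u * cnj (g u)))"
      by (rule integral_bounded_linear[OF bounded_linear_cnj fg, symmetric])
    also have "\<dots> = integral\<^sup>L lborel (\<lambda>u. g u * cnj (f u))"
      by (simp add: mult.commute)
    finally have "cnj (integral\<^sup>L lborel (\<lambda>u. f u * cnj (g u)))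
        = integral\<^sup>L lborel (\<lambda>u. g u * cnj (f u))" .
    then show "Re (integral\<^sup>L lborel (\<lambda>u. f u * cnj (g u)))
        = Re (integral\<^sup>L lborel (\<lambda>u. g u * cnj (f u)))"
      by (metis cnj.sel(1))
  qed
  show "inner (f + g) h = inner f h + inner g h" unfolding inner_L2_def
    by transfer (simp add: L2_rel_def distrib_right square_integrable_mult_cnj)
  show "inner (r *\<^sub>R f) g = r * inner f g" unfolding inner_L2_def scaleR_L2_def
    by transfer (simp add: L2_rel_def mult.assoc)
  have eq: "Re (integral\<^sup>L lborel (\<lambda>u. f u * cnj (f u)))
      = integral\<^sup>L lborel (\<lambda>u. (cmod (f u))\<^sup>2)" for f :: "'a \<Rightarrow> complex"
    by (simp add: complex_norm_square[symmetric] integral_complex_of_real del: of_real_power)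
  show "0 \<le> inner f f" unfolding inner_L2_def
    by transfer (simp add: eq)
  show "(inner f f = 0) = (f = 0)" unfolding inner_L2_def
    by transfer (simp add: eq L2_rel_def square_integrable_def integral_nonneg_eq_0_iff_AE)
qed

end

text \<open>The library's \<^const>\<open>bounded_linear\<close> is only real-linear.\<close>

definition L2_bounded_operator :: "('a::euclidean_space L2 \<Rightarrow> 'a L2) \<Rightarrow> bool" where
  "L2_bounded_operator A \<longleftrightarrow>
     bounded_linear A \<and> (\<forall>c f. A (L2_cscale c f) = L2_cscale c (A f))"


section \<open>Coherent states and the Segal field\<close>

definition coherent_state :: "(real^'n) \<times> (real^'n) \<Rightarrow> real^'n \<Rightarrow> complex" where
  "coherent_state = (\<lambda>(x, \<xi>) u.
     complex_of_real (pi powr (- real CARD('n) / 4)) *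
     exp (- (1/2) * complex_of_real ((norm (u - x))\<^sup>2)
          + \<i> * complex_of_real (u \<bullet> \<xi>)
          - (\<i>/2) * complex_of_real (x \<bullet> \<xi>)))"

definition partial_deriv :: "'n \<Rightarrow> (real^'n \<Rightarrow> complex) \<Rightarrow> real^'n \<Rightarrow> complex" where
  "partial_deriv j f u = vector_derivative (\<lambda>t. f (u + t *\<^sub>R axis j 1)) (at 0)"

definition Phi_S ::
  "(real^'n) \<times> (real^'n) \<Rightarrow> (real^'n \<Rightarrow> complex) \<Rightarrow> real^'n \<Rightarrow> complex" where
  "Phi_S = (\<lambda>(z, \<zeta>) f u.
     \<Sum>j\<in>UNIV. complex_of_real (z $ j) * complex_of_real (u $ j) * f u
            + complex_of_real (\<zeta> $ j) * (1/\<i>) * partial_deriv j f u)"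

text \<open>
  The series for \<open>exp(s \<Phi>\<^sub>S(Z)) f\<close>, summed in the norm of \<open>L\<^sup>2\<close>. The powers of
  \<^const>\<open>Phi_S\<close> act on functions, because it is not defined on all of \<open>L\<^sup>2\<close>.
\<close>

definition exp_Phi_S ::
  "real \<Rightarrow> (real^'n) \<times> (real^'n) \<Rightarrow> (real^'n \<Rightarrow> complex) \<Rightarrow> (real^'n) L2" where
  "exp_Phi_S s Z f = (\<Sum>m. (s ^ m / fact m) *\<^sub>R L2_of ((Phi_S Z ^^ m) f))"

end

theory Submission
  imports Defs "HOL-Probability.Probability"
begin

text \<open>
  With \<open>Z = (z, \<zeta>)\<close>, the operator \<open>\<Phi>\<^sub>S(Z)\<close> acts on \<open>p(w) \<Psi>\<^sub>X\<close>, where \<open>w\<close> is a suitable complex affine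
  function on \<open>\<real>\<^sup>n\<close>, by \<open>p \<mapsto> w p + 2 q p'\<close> with the constant \<open>q = (|\<zeta>|\<^sup>2 - i z \<cdot> \<zeta>) / 2\<close>. This is the recursion
  of the two-variable Hermite polynomials, so that \<open>exp (s \<Phi>\<^sub>S(Z)) \<Psi>\<^sub>X = exp (s w + s\<^sup>2 q) \<Psi>\<^sub>X\<close>; the series
  converges in \<open>L\<^sup>2\<close> because its partial sums are dominated by \<open>exp (|s w| + |s\<^sup>2 q|) |\<Psi>\<^sub>X|\<close>. Completing the
  square, the sum is a constant multiple of \<open>\<Psi>\<close> at \<open>X + s Z\<close>. For \<open>s = 1\<close> and \<open>s = - 1\<close>, the product of
  the first constant with the conjugate of the second is the inverse of the overlap of the two
  shifted states.
\<close>

section \<open>Gaussian integrals\<close>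

text \<open>With \<open>c = sqrt (2 * a)\<close>, rescaling by \<open>c\<close> turns the integrand
  into a multiple of the standard normal density times \<open>iexp (t / c * x)\<close>, so the value
  comes from the characteristic function of the standard normal distribution.\<close>

lemma has_bochner_integral_gaussian_real:
  fixes a t :: real
  assumes "a > 0"
  shows "has_bochner_integral lborel (\<lambda>x. exp (complex_of_real (- a * x\<^sup>2) + \<i> * complex_of_real (t * x)))
           (complex_of_real (sqrt (pi / a) * exp (- t\<^sup>2 / (4 * a))))"
proof -
  define c where "c = sqrt (2 * a)"
  have c: "c > 0" "c\<^sup>2 = 2 * a" using assms by (auto simp: c_def)
  let ?f = "\<lambda>x. complex_of_real (std_normal_density x) * iexp (t / c * x)"
  have "integrable lborel std_normal_density"
    by (rule integrable_normal_density) simp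
  then have int: "integrable lborel ?f"
    by (rule Bochner_Integration.integrable_bound)
       (auto simp: norm_mult simp del: of_real_mult)
  have "(LINT x|lborel. ?f x) = char std_normal_distribution (t / c)"
    unfolding char_def
    by (subst integral_density) (auto simp: normal_density_nonneg scaleR_conv_of_real)
  also have "\<dots> = complex_of_real (exp (- t\<^sup>2 / (4 * a)))"
    by (simp add: char_std_normal_distribution power_divide c)
  finally have "has_bochner_integral lborel ?f (complex_of_real (exp (- t\<^sup>2 / (4 * a))))"
    using int by (simp add: has_bochner_integral_iff)
  then have "has_bochner_integral lborel (\<lambda>x. ?f (0 + c * x)) (complex_of_real (exp (- t\<^sup>2 / (4 * a))) /\<^sub>R \<bar>c\<bar>)"
    using c(1) by (subst (asm) lborel_has_bochner_integral_real_affine_iff[where c=c and t=0]) auto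
  \<comment> \<open>The factor \<open>sqrt (2 * pi)\<close> removes the normalisation of the
    density; the rescaling has contributed the Jacobian \<open>1 / c\<close>.\<close>
  then have "has_bochner_integral lborel (\<lambda>x. complex_of_real (sqrt (2 * pi)) * ?f (0 + c * x))
      (complex_of_real (sqrt (2 * pi)) * (complex_of_real (exp (- t\<^sup>2 / (4 * a))) /\<^sub>R \<bar>c\<bar>))"
    by (rule has_bochner_integral_mult_right)
  moreover have "complex_of_real (sqrt (2 * pi)) * ?f (0 + c * x)
      = exp (complex_of_real (- a * x\<^sup>2) + \<i> * complex_of_real (t * x))" for x
  proof -
    have "complex_of_real (sqrt (2 * pi)) * ?f (0 + c * x)
        = complex_of_real (exp (- (c * x)\<^sup>2 / 2)) * iexp (t * x)"
      using c(1) by (simp add: std_normal_density_def)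
    also have "- (c * x)\<^sup>2 / 2 = - a * x\<^sup>2"
      using c(2) by (simp add: power_mult_distrib)
    finally show ?thesis by (simp only: exp_add exp_of_real)
  qed
  moreover have "complex_of_real (sqrt (2 * pi)) * (complex_of_real (exp (- t\<^sup>2 / (4 * a))) /\<^sub>R \<bar>c\<bar>)
      = complex_of_real (sqrt (pi / a) * exp (- t\<^sup>2 / (4 * a)))"
  proof -
    have "sqrt (2 * pi) / \<bar>c\<bar> = sqrt (pi / a)"
      using assms by (simp add: c_def real_sqrt_mult real_sqrt_divide)
    then have "sqrt (2 * pi) * (inverse \<bar>c\<bar> * e) = sqrt (pi / a) * e" for e
      by (simp only: divide_inverse mult.assoc[symmetric])
    then show ?thesis
      by (simp only: scaleR_conv_of_real of_real_mult[symmetric])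
  qed
  ultimately show ?thesis by simp
qed

text \<open>Fubini: by \<open>lborel_eq\<close>, \<open>lborel\<close> is the image of a finite
  product of one-dimensional Lebesgue measures, and the inner product with \<open>b\<close> recovers
  the coordinate at \<open>b\<close>.\<close>

lemma has_bochner_integral_lborel_prod:
  fixes f :: "'a::euclidean_space \<Rightarrow> real \<Rightarrow> 'b::{real_normed_field,banach,second_countable_topology}"
  assumes "\<And>b. b \<in> Basis \<Longrightarrow> has_bochner_integral lborel (f b) (I b)"
  shows "has_bochner_integral lborel (\<lambda>u. \<Prod>b\<in>Basis. f b (u \<bullet> b)) (\<Prod>b\<in>Basis. I b)"
proof -
  interpret product_sigma_finite "\<lambda>b::'a. lborel :: real measure" by standard
  have f: "integrable lborel (f b)" "integral\<^sup>L lborel (f b) = I b" if "b \<in> Basis" for b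
    using assms[OF that] by (auto simp: has_bochner_integral_iff)
  have [measurable]: "f b \<in> borel_measurable borel" if "b \<in> Basis" for b
    using f(1)[OF that] borel_measurable_integrable by force
  have *: "(\<Prod>b\<in>Basis. f b ((\<Sum>b'\<in>Basis. v b' *\<^sub>R b') \<bullet> b)) = (\<Prod>b\<in>Basis. f b (v b))" for v
    by (intro prod.cong refl) simp
  have "has_bochner_integral (\<Pi>\<^sub>M b\<in>Basis. lborel) (\<lambda>v. \<Prod>b\<in>Basis. f b (v b)) (\<Prod>b\<in>Basis. I b)"
    using product_integral_prod[of Basis f] product_integrable_prod[of Basis f] f
    by (simp add: has_bochner_integral_iff)
  then have "has_bochner_integral (\<Pi>\<^sub>M b\<in>Basis. lborel)
      (\<lambda>v. \<Prod>b\<in>Basis. f b ((\<Sum>b'\<in>Basis. v b' *\<^sub>R b') \<bullet> b)) (\<Prod>b\<in>Basis. I b)"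
    unfolding * .
  then show ?thesis
    unfolding has_bochner_integral_iff
    by (subst (1 2) lborel_eq) (simp add: integrable_distr_eq integral_distr)
qed

text \<open>The squared norm and \<open>t \<bullet> u\<close> are sums over coordinates, so the
  centred integrand is a product of one-dimensional Gaussians.\<close>

lemma has_bochner_integral_gaussian:
  fixes t m :: "'a::euclidean_space"
  assumes "a > 0"
  shows "has_bochner_integral lborel
           (\<lambda>u. exp (complex_of_real (- a * (norm (u - m))\<^sup>2) + \<i> * complex_of_real (t \<bullet> (u - m))))
           (complex_of_real (sqrt (pi / a) ^ DIM('a) * exp (- (norm t)\<^sup>2 / (4 * a))))"
proof -
  have n2: "(norm (v::'a))\<^sup>2 = (\<Sum>b\<in>Basis. (v \<bullet> b)\<^sup>2)" for v
    unfolding power2_norm_eq_inner by (subst euclidean_inner) (simp add: power2_eq_square)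
  have tu: "t \<bullet> u = (\<Sum>b\<in>Basis. (t \<bullet> b) * (u \<bullet> b))" for u
    by (rule euclidean_inner)
  have "has_bochner_integral lborel
      (\<lambda>u. \<Prod>b\<in>Basis. exp (complex_of_real (- a * (u \<bullet> b)\<^sup>2) + \<i> * complex_of_real ((t \<bullet> b) * (u \<bullet> b))))
      (\<Prod>b\<in>Basis. complex_of_real (sqrt (pi / a) * exp (- (t \<bullet> b)\<^sup>2 / (4 * a))))"
    using assms
    by (intro has_bochner_integral_lborel_prod has_bochner_integral_gaussian_real) auto
  also have "(\<lambda>u. \<Prod>b\<in>Basis. exp (complex_of_real (- a * (u \<bullet> b)\<^sup>2) + \<i> * complex_of_real ((t \<bullet> b) * (u \<bullet> b))))
      = (\<lambda>u. exp (complex_of_real (- a * (norm u)\<^sup>2) + \<i> * complex_of_real (t \<bullet> u)))"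
  proof
    fix u
    show "(\<Prod>b\<in>Basis. exp (complex_of_real (- a * (u \<bullet> b)\<^sup>2) + \<i> * complex_of_real ((t \<bullet> b) * (u \<bullet> b))))
        = exp (complex_of_real (- a * (norm u)\<^sup>2) + \<i> * complex_of_real (t \<bullet> u))"
      unfolding n2[of u] tu[of u]
      by (subst exp_sum[symmetric]) (simp_all add: sum.distrib sum_subtractf sum_distrib_left sum_negf)
  qed
  also have "(\<Prod>b\<in>Basis. complex_of_real (sqrt (pi / a) * exp (- (t \<bullet> b)\<^sup>2 / (4 * a))))
      = complex_of_real (sqrt (pi / a) ^ DIM('a) * exp (- (norm t)\<^sup>2 / (4 * a)))"
    unfolding of_real_prod[symmetric] prod.distrib n2[of t]
    by (simp add: exp_sum sum_divide_distrib flip: sum_negf)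
  finally have H: "has_bochner_integral lborel
      (\<lambda>u. exp (complex_of_real (- a * (norm u)\<^sup>2) + \<i> * complex_of_real (t \<bullet> u)))
      (complex_of_real (sqrt (pi / a) ^ DIM('a) * exp (- (norm t)\<^sup>2 / (4 * a))))" .
  \<comment> \<open>Translation invariance of \<open>lborel\<close> moves the centre from 0 to
    \<open>m\<close>.\<close>
  then have "has_bochner_integral (distr lborel borel ((+) (- m)))
      (\<lambda>u. exp (complex_of_real (- a * (norm u)\<^sup>2) + \<i> * complex_of_real (t \<bullet> u)))
      (complex_of_real (sqrt (pi / a) ^ DIM('a) * exp (- (norm t)\<^sup>2 / (4 * a))))"
    by (simp add: lborel_distr_plus)
  then show ?thesis
    unfolding has_bochner_integral_iff
    by (subst (asm) (1) integrable_distr_eq, simp, simp,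
        subst (asm) (1) integral_distr) (simp_all)
qed

section \<open>Series in \<open>L\<^sup>2\<close>\<close>

lemma L2_of_add:
  "square_integrable f \<Longrightarrow> square_integrable g \<Longrightarrow> L2_of (\<lambda>u. f u + g u) = L2_of f + L2_of g"
  by transfer (auto simp: L2_rel_def square_integrable_add)

lemma L2_of_minus: "square_integrable f \<Longrightarrow> L2_of (\<lambda>u. - f u) = - L2_of f"
  by transfer (auto simp: L2_rel_def square_integrable_minus)

lemma L2_of_cscale: "square_integrable f \<Longrightarrow> L2_of (\<lambda>u. c * f u) = L2_cscale c (L2_of f)"
  by transfer (auto simp: L2_rel_def square_integrable_scale)

lemma L2_of_0: "L2_of (\<lambda>u. 0) = 0"
  by transfer (auto simp: L2_rel_def)

lemma square_integrable_sum:
  assumes "\<And>i. i \<in> I \<Longrightarrow> square_integrable (f i)"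
  shows "square_integrable (\<lambda>u. \<Sum>i\<in>I. f i u)"
  using assms by (induction I rule: infinite_finite_induct) (auto intro: square_integrable_add)

lemma L2_of_sum:
  assumes "\<And>i. i \<in> I \<Longrightarrow> square_integrable (f i)"
  shows "L2_of (\<lambda>u. \<Sum>i\<in>I. f i u) = (\<Sum>i\<in>I. L2_of (f i))"
  using assms
  by (induction I rule: infinite_finite_induct) (auto simp: L2_of_0 L2_of_add square_integrable_sum)

lemma L2_inner_L2_of:
  assumes "square_integrable f" "square_integrable g"
  shows "L2_inner (L2_of f) (L2_of g) = integral\<^sup>L lborel (\<lambda>u. f u * cnj (g u))"
  using assms by transfer simp

lemma L2_inner_cscale: "L2_inner (L2_cscale c f) (L2_cscale d g) = c * cnj d * L2_inner f g"
  by transfer (simp add: L2_rel_def square_integrable_mult_cnj mult_ac flip: integral_mult_right_zero)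

lemma norm_L2_of:
  assumes "square_integrable f"
  shows "norm (L2_of f) = sqrt (integral\<^sup>L lborel (\<lambda>u. (cmod (f u))\<^sup>2))"
  using assms
  by (simp add: norm_L2_def L2_inner_L2_of complex_norm_square[symmetric] integral_complex_of_real
      del: of_real_power)

lemma square_integrable_bound:
  assumes "f \<in> borel_measurable lborel" "integrable lborel (\<lambda>u. (B u)\<^sup>2)" "\<And>u. cmod (f u) \<le> B u"
  shows "square_integrable f"
  unfolding square_integrable_def
proof
  show "integrable lborel (\<lambda>u. (cmod (f u))\<^sup>2)"
    by (rule Bochner_Integration.integrable_bound[OF assms(2)])
       (use assms in \<open>auto intro!: power_mono\<close>)
qed fact

text \<open>Dominated convergence: the squared error of the partial sums tends to 0 pointwise and
  stays below \<open>4 * (B u)\<^sup>2\<close>, so pointwise convergence becomes convergence in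
  norm.\<close>

lemma L2_of_sums:
  fixes f :: "nat \<Rightarrow> 'a::euclidean_space \<Rightarrow> complex"
  assumes f [measurable]: "\<And>m. f m \<in> borel_measurable borel"
    and sums: "\<And>u. (\<lambda>m. f m u) sums g u"
    and bound: "\<And>N u. cmod (\<Sum>m<N. f m u) \<le> B u"
    and B: "integrable lborel (\<lambda>u. (B u)\<^sup>2)"
  shows "(\<lambda>m. L2_of (f m)) sums L2_of g"
proof -
  let ?S = "\<lambda>N u. \<Sum>m<N. f m u"
  have lim: "(\<lambda>N. ?S N u) \<longlonglongrightarrow> g u" for u
    using sums by (simp add: sums_def)
  have g [measurable]: "g \<in> borel_measurable borel"
    by (rule borel_measurable_LIMSEQ_metric[where f="?S"]) (auto intro: lim)
  have g_bound: "cmod (g u) \<le> B u" for u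
    by (rule LIMSEQ_le_const2[OF tendsto_norm[OF lim]]) (use bound in auto)
  have si_S: "square_integrable (?S N)" for N
    by (rule square_integrable_bound[OF _ B bound]) simp
  have si_g: "square_integrable g"
    by (rule square_integrable_bound[OF _ B g_bound]) simp
  \<comment> \<open>Only partial sums are bounded by \<open>B\<close>; a single term is the
    difference of two consecutive ones.\<close>
  have si_f: "square_integrable (f m)" for m
    using square_integrable_add[OF si_S[of "Suc m"] square_integrable_minus[OF si_S[of m]]]
    by simp
  have si_d: "square_integrable (\<lambda>u. ?S N u + - g u)" for N
    by (intro square_integrable_add square_integrable_minus si_S si_g)
  have diff: "(\<Sum>m<N. L2_of (f m)) - L2_of g = L2_of (\<lambda>u. ?S N u + - g u)" for N
    by (subst L2_of_add) (auto simp: si_S si_g square_integrable_minus L2_of_minus L2_of_sum si_f)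
  have "(\<lambda>N. integral\<^sup>L lborel (\<lambda>u. (cmod (?S N u + - g u))\<^sup>2)) \<longlonglongrightarrow> integral\<^sup>L lborel (\<lambda>u::'a. 0 :: real)"
  proof (rule integral_dominated_convergence[where w="\<lambda>u. 4 * (B u)\<^sup>2"])
    show "integrable lborel (\<lambda>u. 4 * (B u)\<^sup>2)" using B by simp
    show "AE u in lborel. (\<lambda>N. (cmod (?S N u + - g u))\<^sup>2) \<longlonglongrightarrow> 0"
    proof (rule AE_I2)
      fix u
      have "(\<lambda>N. (cmod (?S N u + - g u))\<^sup>2) \<longlonglongrightarrow> (cmod (g u + - g u))\<^sup>2"
        by (intro tendsto_intros lim)
      then show "(\<lambda>N. (cmod (?S N u + - g u))\<^sup>2) \<longlonglongrightarrow> 0" by simp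
    qed
    show "AE u in lborel. norm ((cmod (?S N u + - g u))\<^sup>2) \<le> 4 * (B u)\<^sup>2" for N
    proof (rule AE_I2)
      fix u
      have "cmod (?S N u + - g u) \<le> 2 * B u"
        using norm_triangle_ineq[of "?S N u" "- g u"] bound[of u N] g_bound[of u] by simp
      then have "(cmod (?S N u + - g u))\<^sup>2 \<le> (2 * B u)\<^sup>2"
        by (rule power_mono) simp
      then show "norm ((cmod (?S N u + - g u))\<^sup>2) \<le> 4 * (B u)\<^sup>2"
        by (simp add: power_mult_distrib)
    qed
  qed simp_all
  then have "(\<lambda>N. norm ((\<Sum>m<N. L2_of (f m)) - L2_of g)) \<longlonglongrightarrow> sqrt 0"
    unfolding diff norm_L2_of[OF si_d] by (intro tendsto_intros) simp
  then show ?thesis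
    unfolding sums_def by (subst LIM_zero_iff[symmetric], subst tendsto_norm_zero_iff[symmetric]) simp
qed

section \<open>Hermite polynomials in two variables\<close>

text \<open>The Taylor coefficients in \<open>s\<close> of \<open>exp (s w + s\<^sup>2 q)\<close>.\<close>

definition hermite_coeff :: "'a::{real_normed_field,banach} \<Rightarrow> 'a \<Rightarrow> nat \<Rightarrow> 'a" where
  "hermite_coeff w q m = (\<Sum>i\<le>m. w ^ i / fact i *
     (if even (m - i) then q ^ ((m - i) div 2) / fact ((m - i) div 2) else 0))"

text \<open>\<open>hermite_coeff w q\<close> is the Cauchy product of the series of
  \<open>exp w\<close> with the series of \<open>exp q\<close> spread over the even indices.\<close>

lemma hermite_coeff_sums: "hermite_coeff w q sums exp (w + q)"
proof -
  let ?F = "\<lambda>i. w ^ i / fact i"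
  let ?G = "\<lambda>k. if even k then q ^ (k div 2) / fact (k div 2) else 0"
  have exp_sums: "(\<lambda>i. x ^ i / fact i) sums exp x" for x :: 'a
    using exp_converges[of x] by (simp add: scaleR_conv_of_real divide_inverse mult.commute)
  have norm_summable: "summable (\<lambda>i. norm (x ^ i / fact i))" for x :: 'a
    using summable_norm_exp[of x] by (simp add: scaleR_conv_of_real divide_inverse mult.commute)
  have sm: "strict_mono (\<lambda>k::nat. 2 * k)" by (simp add: strict_mono_def)
  have not_range: "odd n" if "n \<notin> range ((*) 2)" for n :: nat using that by (auto elim!: evenE)
  \<comment> \<open>\<open>?G\<close> vanishes off the range of \<open>k \<mapsto> 2 * k\<close>, so
    reindexing along this map changes neither the sum nor absolute convergence.\<close>
  have "?G sums exp q"
    using exp_sums[of q] sums_mono_reindex[OF sm, of ?G "exp q"] not_range by auto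
  moreover have "summable (\<lambda>k. norm (?G k))"
    using norm_summable[of q] summable_mono_reindex[OF sm, of "\<lambda>k. norm (?G k)"] not_range by auto
  ultimately show ?thesis
    using Cauchy_product_sums[OF norm_summable[of w], of ?G] exp_sums[of w]
    by (simp add: hermite_coeff_def[abs_def] exp_add sums_iff)
qed

lemma hermite_coeff_0 [simp]: "hermite_coeff w q 0 = 1"
  by (simp add: hermite_coeff_def)

text \<open>Coefficientwise form of the fact that the derivative in \<open>s\<close> of
  \<open>exp (s w + s^2 q)\<close> is \<open>w + 2 s q\<close> times this function. The proof is the
  Leibniz rule for the Cauchy product.\<close>

lemma hermite_coeff_Suc:
  "of_nat (Suc m) * hermite_coeff w q (Suc m)
     = w * hermite_coeff w q m + 2 * q * (if m = 0 then 0 else hermite_coeff w q (m - 1))"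
proof -
  let ?F = "\<lambda>i. w ^ i / fact i"
  let ?G = "\<lambda>k. if even k then q ^ (k div 2) / fact (k div 2) else 0"
  have distr: "(x + y) * (f * g) = x * f * g + f * (y * g)" for x y f g :: 'a
    by (simp add: algebra_simps)
  have F: "of_nat (Suc i) * ?F (Suc i) = w * ?F i" for i
    by (simp del: of_nat_Suc)
  have G: "of_nat (Suc (Suc k)) * ?G (Suc (Suc k)) = 2 * q * ?G k" for k
  proof (cases "even k")
    case True
    then obtain j where k: "k = 2 * j" by (auto elim: evenE)
    have "of_nat (Suc (Suc k)) = (2 * of_nat (Suc j) :: 'a)"
      by (simp add: k)
    moreover have "Suc (Suc k) div 2 = Suc j" "k div 2 = j" using k by auto
    ultimately show ?thesis using True by (simp del: of_nat_Suc)
  qed simp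
  \<comment> \<open>The degree \<open>Suc m\<close> is split as \<open>i + (Suc m - i)\<close>, one
    summand for each factor of the product.\<close>
  have "of_nat (Suc m) * hermite_coeff w q (Suc m)
      = (\<Sum>i\<le>Suc m. (of_nat i + of_nat (Suc m - i)) * (?F i * ?G (Suc m - i)))"
    unfolding hermite_coeff_def sum_distrib_left
    by (intro sum.cong refl) (simp flip: of_nat_add)
  also have "\<dots> = (\<Sum>i\<le>Suc m. (of_nat i * ?F i) * ?G (Suc m - i))
                 + (\<Sum>i\<le>Suc m. ?F i * (of_nat (Suc m - i) * ?G (Suc m - i)))"
    by (simp only: distr sum.distrib)
  also have "(\<Sum>i\<le>Suc m. (of_nat i * ?F i) * ?G (Suc m - i)) = w * hermite_coeff w q m"
    unfolding sum.atMost_Suc_shift F hermite_coeff_def sum_distrib_left diff_Suc_Suc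
    by (simp add: mult.assoc)
  also have "(\<Sum>i\<le>Suc m. ?F i * (of_nat (Suc m - i) * ?G (Suc m - i)))
      = 2 * q * (if m = 0 then 0 else hermite_coeff w q (m - 1))"
  proof (cases m)
    case (Suc p)
    \<comment> \<open>The two top terms vanish: \<open>i = Suc m\<close> has the factor 0, and
      \<open>i = m\<close> has \<open>?G 1 = 0\<close> because 1 is odd.\<close>
    have "(\<Sum>i\<le>Suc m. ?F i * (of_nat (Suc m - i) * ?G (Suc m - i)))
        = (\<Sum>i\<le>p. ?F i * (of_nat (Suc m - i) * ?G (Suc m - i)))"
      by (simp add: Suc)
    also have "\<dots> = (\<Sum>i\<le>p. ?F i * (2 * q * ?G (p - i)))"
    proof (intro sum.cong refl)
      fix i assume "i \<in> {..p}"
      then have "Suc m - i = Suc (Suc (p - i))" by (simp add: Suc)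
      then show "?F i * (of_nat (Suc m - i) * ?G (Suc m - i)) = ?F i * (2 * q * ?G (p - i))"
        by (simp only: G)
    qed
    finally show ?thesis
      by (simp add: Suc hermite_coeff_def sum_distrib_left mult_ac)
  qed simp
  finally show ?thesis .
qed

text \<open>Differentiating \<open>exp (s w + s^2 q)\<close> in \<open>w\<close> multiplies it by
  \<open>s\<close>, which shifts the coefficients by one.\<close>

lemma hermite_coeff_has_field_derivative:
  "((\<lambda>w. hermite_coeff w q m) has_field_derivative
      (if m = 0 then 0 else hermite_coeff w q (m - 1))) (at w)"
proof (cases m)
  case (Suc p)
  let ?G = "\<lambda>k. if even k then q ^ (k div 2) / fact (k div 2) else 0"
  have "((\<lambda>w. \<Sum>i\<le>Suc p. w ^ i / fact i * ?G (Suc p - i)) has_field_derivative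
      (\<Sum>i\<le>Suc p. of_nat i * w ^ (i - 1) / fact i * ?G (Suc p - i))) (at w)"
    by (intro DERIV_sum DERIV_cmult_right DERIV_cdivide) (auto intro!: derivative_eq_intros)
  \<comment> \<open>At \<open>i = 0\<close> the factor \<open>of_nat i\<close> is 0, so the
    truncated exponent \<open>i - 1\<close> does no harm there.\<close>
  also have "(\<Sum>i\<le>Suc p. of_nat i * w ^ (i - 1) / fact i * ?G (Suc p - i)) = hermite_coeff w q p"
    unfolding sum.atMost_Suc_shift hermite_coeff_def diff_Suc_Suc
    by (simp del: of_nat_Suc)
  finally show ?thesis by (simp add: Suc hermite_coeff_def)
qed simp

text \<open>Weighted homogeneity, with \<open>w\<close> of degree 1 and \<open>q\<close> of degree
  2. It absorbs the powers of \<open>s\<close> in the exponential series into the arguments.\<close>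

lemma hermite_coeff_scale: "hermite_coeff (s * w) (s\<^sup>2 * q) m = s ^ m * hermite_coeff w q m"
  unfolding hermite_coeff_def sum_distrib_left
proof (intro sum.cong refl)
  fix i assume "i \<in> {..m}"
  then have m: "s ^ m = s ^ i * s ^ (m - i)" by (simp flip: power_add)
  have even: "s ^ (m - i) = (s\<^sup>2) ^ ((m - i) div 2)" if "even (m - i)"
    using that by (simp flip: power_mult)
  show "(s * w) ^ i / fact i *
      (if even (m - i) then (s\<^sup>2 * q) ^ ((m - i) div 2) / fact ((m - i) div 2) else 0)
    = s ^ m * (w ^ i / fact i *
      (if even (m - i) then q ^ ((m - i) div 2) / fact ((m - i) div 2) else 0))"
    unfolding m by (auto simp: power_mult_distrib even)
qed

lemma norm_hermite_coeff_le: "norm (hermite_coeff w q m) \<le> hermite_coeff (norm w) (norm q) m"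
  unfolding hermite_coeff_def
  by (rule order.trans[OF norm_sum], intro sum_mono) (simp add: norm_mult norm_divide norm_power)

text \<open>At the arguments \<open>norm w\<close> and \<open>norm q\<close> the series has
  nonnegative terms and majorises the given one. The bound is uniform in \<open>N\<close>, as
  domination requires.\<close>

lemma sum_norm_hermite_coeff_le:
  "(\<Sum>m<N. norm (hermite_coeff w q m)) \<le> exp (norm w + norm q)"
proof -
  have nonneg: "0 \<le> hermite_coeff (norm w) (norm q) m" for m
    using norm_hermite_coeff_le[of w q m] norm_ge_zero order.trans by blast
  have "(\<Sum>m<N. norm (hermite_coeff w q m)) \<le> (\<Sum>m<N. hermite_coeff (norm w) (norm q) m)"
    by (intro sum_mono norm_hermite_coeff_le)
  also have "\<dots> \<le> exp (norm w + norm q)"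
    using sum_le_suminf[of "hermite_coeff (norm w) (norm q)" "{..<N}"] nonneg
      hermite_coeff_sums[of "norm w" "norm q"] by (auto simp: sums_iff)
  finally show ?thesis .
qed

lemma continuous_on_hermite_coeff [continuous_intros]:
  assumes "continuous_on S f"
  shows "continuous_on S (\<lambda>u. hermite_coeff (f u) q m)"
proof (rule continuous_on_compose2[OF _ assms subset_UNIV])
  show "continuous_on UNIV (\<lambda>w. hermite_coeff w q m)"
    by (rule DERIV_continuous_on[OF has_field_derivative_at_within]) (rule hermite_coeff_has_field_derivative)
qed

section \<open>Coherent states\<close>

definition symplectic :: "'a::real_inner \<times> 'a \<Rightarrow> 'a \<times> 'a \<Rightarrow> real" where
  "symplectic X Y = fst Y \<bullet> snd X - fst X \<bullet> snd Y"

text \<open>The exponent is separated into real and imaginary parts, which makes moduli and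
  conjugates easy to read off.\<close>

lemma coherent_state_eq:
  fixes X :: "(real^'n) \<times> (real^'n)"
  shows "coherent_state X u = complex_of_real (pi powr (- real CARD('n) / 4)) *
     exp (complex_of_real (- (norm (u - fst X))\<^sup>2 / 2)
          + \<i> * complex_of_real (u \<bullet> snd X - fst X \<bullet> snd X / 2))"
  by (simp add: coherent_state_def case_prod_beta algebra_simps)

lemma continuous_on_coherent_state [continuous_intros]: "continuous_on S (coherent_state X)"
  unfolding coherent_state_eq[abs_def] by (intro continuous_intros) simp_all

lemma norm_coherent_state:
  fixes X :: "(real^'n) \<times> (real^'n)"
  shows "cmod (coherent_state X u) = pi powr (- real CARD('n) / 4) * exp (- (norm (u - fst X))\<^sup>2 / 2)"
  by (simp add: coherent_state_eq norm_mult)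

lemma integrable_gaussian:
  fixes m :: "'a::euclidean_space"
  assumes "a > 0"
  shows "integrable lborel (\<lambda>u. exp (- a * (norm (u - m))\<^sup>2))"
proof -
  have "integrable lborel (\<lambda>u. norm (exp (complex_of_real (- a * (norm (u - m))\<^sup>2) +
      \<i> * complex_of_real (0 \<bullet> (u - m)))))"
    by (intro integrable_norm)
       (use has_bochner_integral_gaussian[OF assms, of m 0] in \<open>simp add: has_bochner_integral_iff\<close>)
  then show ?thesis by simp
qed

lemma square_integrable_coherent_state: "square_integrable (coherent_state X)"
proof (rule square_integrable_bound)
  show "coherent_state X \<in> borel_measurable lborel"
    by (simp add: borel_measurable_continuous_onI continuous_on_coherent_state)
  show "integrable lborel (\<lambda>u. (cmod (coherent_state X u))\<^sup>2)"
    using integrable_gaussian[of 1 "fst X"]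
    by (simp add: norm_coherent_state power_mult_distrib flip: exp_double)
qed simp

text \<open>Completing the square makes the product a Gaussian centred at the midpoint
  \<open>m\<close> with frequency \<open>t\<close>. The square leaves the distance of the positions
  in \<open>K\<close>; the Fourier transform supplies that of the momenta.\<close>

lemma coherent_state_inner:
  fixes X Y :: "(real^'n) \<times> (real^'n)"
  shows "L2_inner (L2_of (coherent_state X)) (L2_of (coherent_state Y))
       = exp (complex_of_real (- (norm (X - Y))\<^sup>2 / 4) + \<i> * complex_of_real (symplectic X Y / 2))"
proof -
  define m where "m = (1/2) *\<^sub>R (fst X + fst Y)"
  define t where "t = snd X - snd Y"
  define K where "K = exp (complex_of_real (- (norm (fst X - fst Y))\<^sup>2 / 4) + \<i> * complex_of_real (symplectic X Y / 2))"
  define C where "C = pi powr (- real CARD('n) / 2)"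
  have C: "complex_of_real (pi powr (- real CARD('n) / 4)) * complex_of_real (pi powr (- real CARD('n) / 4)) = complex_of_real C"
    by (simp add: C_def flip: of_real_mult powr_add)
  \<comment> \<open>The normalising constants of the two states cancel the value of the Gaussian
    integral.\<close>
  have pw: "C * sqrt pi ^ CARD('n) = 1"
    by (simp add: C_def powr_half_sqrt[symmetric] powr_realpow[symmetric] powr_powr flip: powr_add)
  have "coherent_state X u * cnj (coherent_state Y u)
      = complex_of_real C * K * exp (complex_of_real (- 1 * (norm (u - m))\<^sup>2) + \<i> * complex_of_real (t \<bullet> (u - m)))" for u
  proof -
    have "coherent_state X u * cnj (coherent_state Y u)
      = complex_of_real C *
        exp ((complex_of_real (- (norm (u - fst X))\<^sup>2 / 2)
          + \<i> * complex_of_real (u \<bullet> snd X - fst X \<bullet> snd X / 2))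
          + (complex_of_real (- (norm (u - fst Y))\<^sup>2 / 2)
          - \<i> * complex_of_real (u \<bullet> snd Y - fst Y \<bullet> snd Y / 2)))"
      unfolding coherent_state_eq C[symmetric]
      by (subst exp_add) (simp add: exp_cnj del: of_real_diff of_real_minus of_real_divide of_real_power)
    also have "(complex_of_real (- (norm (u - fst X))\<^sup>2 / 2)
          + \<i> * complex_of_real (u \<bullet> snd X - fst X \<bullet> snd X / 2))
          + (complex_of_real (- (norm (u - fst Y))\<^sup>2 / 2)
          - \<i> * complex_of_real (u \<bullet> snd Y - fst Y \<bullet> snd Y / 2))
        = (complex_of_real (- (norm (fst X - fst Y))\<^sup>2 / 4) + \<i> * complex_of_real (symplectic X Y / 2))
         + (complex_of_real (- 1 * (norm (u - m))\<^sup>2) + \<i> * complex_of_real (t \<bullet> (u - m)))"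
      unfolding complex_eq_iff m_def t_def symplectic_def power2_norm_eq_inner
      by (simp add: inner_simps inner_commute algebra_simps) (simp add: field_simps)
    finally show ?thesis by (simp add: K_def exp_add mult.assoc)
  qed
  then have "L2_inner (L2_of (coherent_state X)) (L2_of (coherent_state Y))
      = complex_of_real C * K * complex_of_real (sqrt (pi / 1) ^ DIM(real^'n) * exp (- (norm t)\<^sup>2 / (4 * 1)))"
    using has_bochner_integral_gaussian[of 1 m t]
    by (simp add: L2_inner_L2_of square_integrable_coherent_state has_bochner_integral_iff)
  also have "\<dots> = complex_of_real (C * sqrt pi ^ CARD('n)) * (K * exp (complex_of_real (- (norm t)\<^sup>2 / 4)))"
    by (simp flip: exp_of_real)
  also have "\<dots> = K * exp (complex_of_real (- (norm t)\<^sup>2 / 4))"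
    unfolding pw by simp
  also have "\<dots> = exp (complex_of_real (- (norm (X - Y))\<^sup>2 / 4) + \<i> * complex_of_real (symplectic X Y / 2))"
    unfolding K_def t_def exp_add[symmetric]
    by (rule arg_cong[where f=exp]) (simp add: norm_prod_def complex_eq_iff field_simps)
  finally show ?thesis .
qed

section \<open>Powers of the Segal field\<close>

text \<open>\<open>Phi_S Z (coherent_state X)\<close> is \<open>coherent_state X\<close> times this affine function.\<close>

definition segal_symbol ::
  "(real^'n) \<times> (real^'n) \<Rightarrow> (real^'n) \<times> (real^'n) \<Rightarrow> real^'n \<Rightarrow> complex" where
  "segal_symbol Z X u = complex_of_real (fst Z \<bullet> u + snd Z \<bullet> snd X)
     + \<i> * complex_of_real (snd Z \<bullet> (u - fst X))"

definition segal_quad :: "(real^'n) \<times> (real^'n) \<Rightarrow> complex" where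
  "segal_quad Z = (complex_of_real (snd Z \<bullet> snd Z) - \<i> * complex_of_real (fst Z \<bullet> snd Z)) / 2"

text \<open>Product rule: multiplication together with the derivative of the coherent state gives
  the factor \<open>segal_symbol Z X u\<close>, and the derivative of the composition with
  \<open>p\<close> gives \<open>2 * segal_quad Z * p'\<close>.\<close>

lemma Phi_S_mult_coherent_state:
  fixes X Z :: "(real^'n) \<times> (real^'n)"
  assumes "(p has_field_derivative p') (at (segal_symbol Z X u))"
  shows "Phi_S Z (\<lambda>u. p (segal_symbol Z X u) * coherent_state X u) u
       = (segal_symbol Z X u * p (segal_symbol Z X u) + 2 * segal_quad Z * p') * coherent_state X u"
proof -
  let ?w = "segal_symbol Z X" and ?\<Psi> = "coherent_state X"
  \<comment> \<open>\<open>c j\<close> is the \<open>j\<close>-th partial derivative of the symbol,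
    \<open>d j\<close> the logarithmic one of the coherent state at \<open>u\<close>.\<close>
  define c where "c j = complex_of_real (fst Z $ j) + \<i> * complex_of_real (snd Z $ j)" for j
  define d where "d j = complex_of_real (fst X $ j - u $ j) + \<i> * complex_of_real (snd X $ j)" for j
  have pd: "partial_deriv j (\<lambda>u. p (?w u) * ?\<Psi> u) u = (p' * c j + p (?w u) * d j) * ?\<Psi> u" for j
  proof -
    have w: "?w (u + t *\<^sub>R axis j 1) = ?w u + complex_of_real t * c j" for t
      by (simp add: segal_symbol_def c_def complex_eq_iff inner_simps inner_axis algebra_simps)
    have \<Psi>: "?\<Psi> (u + t *\<^sub>R axis j 1)
        = ?\<Psi> u * exp (complex_of_real t * d j - (complex_of_real t)\<^sup>2 / 2)" for t
    proof -
      have "complex_of_real (- (norm (u + t *\<^sub>R axis j 1 - fst X))\<^sup>2 / 2)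
          + \<i> * complex_of_real ((u + t *\<^sub>R axis j 1) \<bullet> snd X - fst X \<bullet> snd X / 2)
        = (complex_of_real (- (norm (u - fst X))\<^sup>2 / 2)
          + \<i> * complex_of_real (u \<bullet> snd X - fst X \<bullet> snd X / 2))
          + (complex_of_real t * d j - (complex_of_real t)\<^sup>2 / 2)"
        unfolding power2_norm_eq_inner
        by (simp add: d_def complex_eq_iff inner_simps inner_axis inner_axis' algebra_simps power2_eq_square)
           (simp add: field_simps)
      then show ?thesis by (simp add: coherent_state_eq exp_add mult.assoc)
    qed
    \<comment> \<open>Along the axis everything extends to complex \<open>t\<close>, so the
      derivative is computed over the complex numbers and then restricted to real
      \<open>t\<close>.\<close>
    have "((\<lambda>t. p (?w u + t * c j) * (?\<Psi> u * exp (t * d j - t\<^sup>2 / 2)))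
        has_field_derivative (p' * c j + p (?w u) * d j) * ?\<Psi> u) (at (complex_of_real 0))"
    proof -
      have "((\<lambda>t. p (?w u + t * c j)) has_field_derivative p' * c j) (at 0)"
        by (rule DERIV_chain2[where f=p]) (use assms in \<open>auto intro!: derivative_eq_intros\<close>)
      moreover have "((\<lambda>t. ?\<Psi> u * exp (t * d j - t\<^sup>2 / 2)) has_field_derivative ?\<Psi> u * d j) (at 0)"
        by (auto intro!: derivative_eq_intros)
      ultimately have "((\<lambda>t. p (?w u + t * c j) * (?\<Psi> u * exp (t * d j - t\<^sup>2 / 2))) has_field_derivative
          p' * c j * (?\<Psi> u * exp (0 * d j - 0\<^sup>2 / 2)) + ?\<Psi> u * d j * p (?w u + 0 * c j)) (at 0)"
        by (rule DERIV_mult)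
      then show ?thesis by (simp add: algebra_simps)
    qed
    from has_vector_derivative_real_field[OF this] show ?thesis
      unfolding partial_deriv_def w \<Psi> by (rule vector_derivative_at)
  qed
  have sc: "(\<Sum>j\<in>UNIV. complex_of_real (snd Z $ j) * (1 / \<i>) * c j) = 2 * segal_quad Z"
    by (simp add: segal_quad_def c_def complex_eq_iff inner_vec_def Re_divide Im_divide
        sum_negf algebra_simps)
  have sd: "(\<Sum>j\<in>UNIV. complex_of_real (fst Z $ j) * complex_of_real (u $ j)
      + complex_of_real (snd Z $ j) * (1 / \<i>) * d j) = ?w u"
    by (simp add: segal_symbol_def d_def complex_eq_iff inner_vec_def
        sum.distrib sum_subtractf algebra_simps)
  have "Phi_S Z (\<lambda>u. p (?w u) * ?\<Psi> u) u
      = (\<Sum>j\<in>UNIV. (complex_of_real (fst Z $ j) * complex_of_real (u $ j)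
            + complex_of_real (snd Z $ j) * (1 / \<i>) * d j) * (p (?w u) * ?\<Psi> u)
          + (complex_of_real (snd Z $ j) * (1 / \<i>) * c j) * (p' * ?\<Psi> u))"
    unfolding Phi_S_def case_prod_beta pd
    by (intro sum.cong refl) (simp add: algebra_simps)
  also have "\<dots> = ?w u * (p (?w u) * ?\<Psi> u) + 2 * segal_quad Z * (p' * ?\<Psi> u)"
    by (simp only: sum.distrib[of "\<lambda>j. _ j * (p (?w u) * ?\<Psi> u)"] sum_distrib_right[symmetric] sc sd)
  finally show ?thesis by (simp add: algebra_simps)
qed

text \<open>In the induction step the derivative of the coefficient is its predecessor, so
  \<open>hermite_coeff_Suc\<close> produces the next one and the factor \<open>Suc m\<close> of the
  factorial.\<close>

lemma Phi_S_power_coherent_state: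
  "(Phi_S Z ^^ m) (coherent_state X)
     = (\<lambda>u. fact m * hermite_coeff (segal_symbol Z X u) (segal_quad Z) m * coherent_state X u)"
proof (induction m)
  case (Suc m)
  let ?q = "segal_quad Z"
  let ?w = "segal_symbol Z X" and ?H = "\<lambda>w. hermite_coeff w (segal_quad Z)"
  have deriv: "((\<lambda>w. fact m * ?H w m) has_field_derivative
      fact m * (if m = 0 then 0 else ?H w (m - 1))) (at w)" for w
    by (intro DERIV_cmult hermite_coeff_has_field_derivative)
  show ?case
  proof
    fix u
    have "(Phi_S Z ^^ Suc m) (coherent_state X) u
        = (?w u * (fact m * ?H (?w u) m) + 2 * ?q * (fact m * (if m = 0 then 0 else ?H (?w u) (m - 1))))
          * coherent_state X u"
      using Phi_S_mult_coherent_state[OF deriv] by (simp only: funpow.simps o_apply Suc)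
    also have "\<dots> = fact m * (?w u * ?H (?w u) m + 2 * ?q * (if m = 0 then 0 else ?H (?w u) (m - 1)))
        * coherent_state X u"
      by (simp only: distrib_left mult_ac)
    also have "\<dots> = fact (Suc m) * ?H (?w u) (Suc m) * coherent_state X u"
      unfolding hermite_coeff_Suc[symmetric] fact_Suc by (simp only: mult_ac)
    finally show "(Phi_S Z ^^ Suc m) (coherent_state X) u
      = fact (Suc m) * ?H (?w u) (Suc m) * coherent_state X u" .
  qed
qed simp

section \<open>Gaussian domination and summation of the exponential series\<close>

lemma continuous_on_segal_symbol [continuous_intros]: "continuous_on S (segal_symbol Z X)"
  unfolding segal_symbol_def[abs_def] by (intro continuous_intros)

text \<open>The symbol grows at most linearly, so its exponential is absorbed by half of the
  Gaussian exponent of the squared coherent state.\<close>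

lemma integrable_exp_segal_symbol:
  fixes X Z :: "(real^'n) \<times> (real^'n)"
  assumes "s \<ge> 0"
  shows "integrable lborel (\<lambda>u. (exp (s * cmod (segal_symbol Z X u) + k) * cmod (coherent_state X u))\<^sup>2)"
proof (rule Bochner_Integration.integrable_bound)
  \<comment> \<open>\<open>a\<close> bounds the slope of the symbol, and \<open>b\<close> is its
    modulus at the centre \<open>fst X\<close>.\<close>
  define a where "a = norm (fst Z) + norm (snd Z)"
  define b where "b = \<bar>fst Z \<bullet> fst X + snd Z \<bullet> snd X\<bar>"
  define C where "C = pi powr (- real CARD('n) / 4)"
  let ?M = "C\<^sup>2 * exp (2 * k + 2 * s * b + 2 * s\<^sup>2 * a\<^sup>2)"
  show "integrable lborel (\<lambda>u. ?M * exp (- (1/2) * (norm (u - fst X))\<^sup>2))"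
    by (intro integrable_mult_right integrable_gaussian) simp
  show "(\<lambda>u. (exp (s * cmod (segal_symbol Z X u) + k) * cmod (coherent_state X u))\<^sup>2) \<in> borel_measurable lborel"
    unfolding measurable_lborel2 by (intro borel_measurable_continuous_onI continuous_intros)
  show "AE u in lborel. norm ((exp (s * cmod (segal_symbol Z X u) + k) * cmod (coherent_state X u))\<^sup>2)
      \<le> norm (?M * exp (- (1/2) * (norm (u - fst X))\<^sup>2))"
  proof (rule AE_I2)
    fix u
    define r where "r = norm (u - fst X)"
    have "segal_symbol Z X u = complex_of_real (fst Z \<bullet> (u - fst X))
        + (complex_of_real (fst Z \<bullet> fst X + snd Z \<bullet> snd X) + \<i> * complex_of_real (snd Z \<bullet> (u - fst X)))"
      by (simp add: segal_symbol_def inner_diff_right)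
    also have "cmod \<dots> \<le> \<bar>fst Z \<bullet> (u - fst X)\<bar> + (b + \<bar>snd Z \<bullet> (u - fst X)\<bar>)"
      unfolding b_def
      by (rule norm_triangle_mono, simp only: norm_of_real real_norm_def, rule norm_triangle_mono)
         (simp_all only: norm_mult norm_ii norm_of_real real_norm_def mult_1)
    also have "\<dots> \<le> a * r + b"
      using Cauchy_Schwarz_ineq2[of "fst Z" "u - fst X"] Cauchy_Schwarz_ineq2[of "snd Z" "u - fst X"]
      by (simp add: a_def r_def distrib_right)
    finally have "s * cmod (segal_symbol Z X u) \<le> s * (a * r + b)"
      using assms by (rule mult_left_mono)
    \<comment> \<open>This is \<open>0 \<le> (r - 2 * s * a)\<^sup>2\<close> divided by 2; it spends
      half of the available \<open>r\<^sup>2\<close>.\<close>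
    moreover have "2 * (s * a * r) \<le> r\<^sup>2 / 2 + 2 * s\<^sup>2 * a\<^sup>2"
      using zero_le_power2[of "r - 2 * (s * a)"]
      by (simp add: power2_diff power_mult_distrib algebra_simps)
    ultimately have "2 * (s * cmod (segal_symbol Z X u) + k) - r\<^sup>2
        \<le> 2 * k + 2 * s * b + 2 * s\<^sup>2 * a\<^sup>2 - (1/2) * r\<^sup>2"
      by (simp add: algebra_simps)
    then have "C\<^sup>2 * exp (2 * (s * cmod (segal_symbol Z X u) + k) - r\<^sup>2)
        \<le> C\<^sup>2 * exp (2 * k + 2 * s * b + 2 * s\<^sup>2 * a\<^sup>2 - (1/2) * r\<^sup>2)"
      by (intro mult_left_mono) auto
    also have "C\<^sup>2 * exp (2 * (s * cmod (segal_symbol Z X u) + k) - r\<^sup>2)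
        = (exp (s * cmod (segal_symbol Z X u) + k) * cmod (coherent_state X u))\<^sup>2"
      unfolding norm_coherent_state C_def[symmetric] r_def[symmetric] power_mult_distrib exp_double[symmetric]
      by (simp add: exp_diff exp_minus field_simps)
    also have "C\<^sup>2 * exp (2 * k + 2 * s * b + 2 * s\<^sup>2 * a\<^sup>2 - (1/2) * r\<^sup>2)
        = ?M * exp (- (1/2) * r\<^sup>2)"
      by (simp only: mult.assoc mult_minus_left diff_conv_add_uminus exp_add)
    finally show "norm ((exp (s * cmod (segal_symbol Z X u) + k) * cmod (coherent_state X u))\<^sup>2)
      \<le> norm (?M * exp (- (1/2) * (norm (u - fst X))\<^sup>2))"
      unfolding r_def by simp
  qed
qed

text \<open>Ensures that \<open>L2_of\<close> takes the true class of each power and not its default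
  value 0.\<close>

lemma square_integrable_Phi_S_power: "square_integrable ((Phi_S Z ^^ m) (coherent_state X))"
proof -
  let ?f = "\<lambda>u. hermite_coeff (segal_symbol Z X u) (segal_quad Z) m * coherent_state X u"
  have "square_integrable ?f"
  proof (rule square_integrable_bound)
    show "?f \<in> borel_measurable lborel"
      unfolding measurable_lborel2 by (intro borel_measurable_continuous_onI continuous_intros)
    show "integrable lborel (\<lambda>u. (exp (1 * cmod (segal_symbol Z X u) + cmod (segal_quad Z))
        * cmod (coherent_state X u))\<^sup>2)"
      by (rule integrable_exp_segal_symbol) simp
    show "cmod (?f u) \<le> exp (1 * cmod (segal_symbol Z X u) + cmod (segal_quad Z))
        * cmod (coherent_state X u)" for u
    proof -
      have "cmod (hermite_coeff (segal_symbol Z X u) (segal_quad Z) m)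
          \<le> (\<Sum>i<Suc m. cmod (hermite_coeff (segal_symbol Z X u) (segal_quad Z) i))"
        by (rule member_le_sum) auto
      also have "\<dots> \<le> exp (cmod (segal_symbol Z X u) + cmod (segal_quad Z))"
        by (rule sum_norm_hermite_coeff_le)
      finally show ?thesis by (simp add: norm_mult mult_right_mono)
    qed
  qed
  from square_integrable_scale[OF this, of "fact m"] show ?thesis
    by (simp add: Phi_S_power_coherent_state mult.assoc)
qed

text \<open>The scalar is what remains after completing the square around
  \<open>X + s *\<^sub>R Z\<close>: the real part of its exponent corrects the norm, the imaginary
  part is the symplectic phase.\<close>

lemma exp_Phi_S_coherent_state:
  fixes X Z :: "(real^'n) \<times> (real^'n)"
  shows "exp_Phi_S s Z (coherent_state X)
       = L2_cscale (exp (complex_of_real (s * (X \<bullet> Z) + s\<^sup>2 * (norm Z)\<^sup>2 / 2)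
             + \<i> * complex_of_real (s * symplectic X Z / 2)))
           (L2_of (coherent_state (X + s *\<^sub>R Z)))"
proof -
  let ?w = "\<lambda>u. complex_of_real s * segal_symbol Z X u"
    and ?q = "(complex_of_real s)\<^sup>2 * segal_quad Z" and ?\<Psi> = "coherent_state X"
  let ?f = "\<lambda>m u. hermite_coeff (?w u) ?q m * ?\<Psi> u"
  let ?K = "exp (complex_of_real (s * (X \<bullet> Z) + s\<^sup>2 * (norm Z)\<^sup>2 / 2)
             + \<i> * complex_of_real (s * symplectic X Z / 2))"
  define B where "B u = exp (\<bar>s\<bar> * cmod (segal_symbol Z X u) + cmod ?q) * cmod (?\<Psi> u)" for u
  \<comment> \<open>The factorial from the power formula cancels \<open>fact m\<close>, and
    \<open>hermite_coeff_scale\<close> absorbs \<open>s ^ m\<close>.\<close>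
  have L2_term: "(s ^ m / fact m) *\<^sub>R L2_of ((Phi_S Z ^^ m) ?\<Psi>) = L2_of (?f m)" for m
  proof -
    have "(s ^ m / fact m) *\<^sub>R L2_of ((Phi_S Z ^^ m) ?\<Psi>)
        = L2_of (\<lambda>u. complex_of_real (s ^ m / fact m) * (Phi_S Z ^^ m) ?\<Psi> u)"
      by (simp only: scaleR_L2_def L2_of_cscale square_integrable_Phi_S_power)
    also have "(\<lambda>u. complex_of_real (s ^ m / fact m) * (Phi_S Z ^^ m) ?\<Psi> u) = ?f m"
      unfolding Phi_S_power_coherent_state hermite_coeff_scale by (simp add: field_simps)
    finally show ?thesis .
  qed
  have "(\<lambda>m. L2_of (?f m)) sums L2_of (\<lambda>u. exp (?w u + ?q) * ?\<Psi> u)"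
  proof (rule L2_of_sums)
    show "?f m \<in> borel_measurable borel" for m
      by (intro borel_measurable_continuous_onI continuous_intros)
    show "(\<lambda>m. ?f m u) sums (exp (?w u + ?q) * ?\<Psi> u)" for u
      by (intro sums_mult2 hermite_coeff_sums)
    show "cmod (\<Sum>m<N. ?f m u) \<le> B u" for N u
    proof -
      have "cmod (\<Sum>m<N. hermite_coeff (?w u) ?q m) \<le> exp (cmod (?w u) + cmod ?q)"
        using norm_sum sum_norm_hermite_coeff_le by (rule order.trans)
      then show ?thesis
        by (simp add: B_def norm_mult mult_right_mono flip: sum_distrib_right)
    qed
    show "integrable lborel (\<lambda>u. (B u)\<^sup>2)"
      unfolding B_def by (rule integrable_exp_segal_symbol) simp
  qed
  \<comment> \<open>Convergence being established, the infinite sum is the genuine limit in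
    norm.\<close>
  then have "exp_Phi_S s Z ?\<Psi> = L2_of (\<lambda>u. exp (?w u + ?q) * ?\<Psi> u)"
    unfolding exp_Phi_S_def L2_term by (rule sums_unique[symmetric])
  also have "(\<lambda>u. exp (?w u + ?q) * ?\<Psi> u) = (\<lambda>u. ?K * coherent_state (X + s *\<^sub>R Z) u)"
  proof
    fix u
    have "(?w u + ?q) + (complex_of_real (- (norm (u - fst X))\<^sup>2 / 2)
          + \<i> * complex_of_real (u \<bullet> snd X - fst X \<bullet> snd X / 2))
      = (complex_of_real (s * (X \<bullet> Z) + s\<^sup>2 * (norm Z)\<^sup>2 / 2)
             + \<i> * complex_of_real (s * symplectic X Z / 2))
        + (complex_of_real (- (norm (u - fst (X + s *\<^sub>R Z)))\<^sup>2 / 2)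
          + \<i> * complex_of_real (u \<bullet> snd (X + s *\<^sub>R Z) - fst (X + s *\<^sub>R Z) \<bullet> snd (X + s *\<^sub>R Z) / 2))"
      unfolding power2_norm_eq_inner segal_symbol_def segal_quad_def symplectic_def inner_prod_def
      by (simp add: complex_eq_iff inner_simps inner_commute algebra_simps power2_eq_square)
         (simp add: field_simps)
    then show "exp (?w u + ?q) * ?\<Psi> u = ?K * coherent_state (X + s *\<^sub>R Z) u"
      unfolding coherent_state_eq mult.left_commute[of "exp _" "complex_of_real _"] exp_add[symmetric]
      by simp
  qed
  finally show ?thesis
    by (simp add: L2_of_cscale square_integrable_coherent_state)
qed

section \<open>The quotient identity for bounded operators\<close>

theorem theorem1p4:
  fixes A :: "(real^'n) L2 \<Rightarrow> (real^'n) L2"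
    and X Z :: "(real^'n) \<times> (real^'n)"
  assumes "L2_bounded_operator A"
  shows "L2_inner (A (L2_of (coherent_state (X + Z)))) (L2_of (coherent_state (X - Z)))
           / L2_inner (L2_of (coherent_state (X + Z))) (L2_of (coherent_state (X - Z)))
         = L2_inner (A (exp_Phi_S 1 Z (coherent_state X))) (exp_Phi_S (- 1) Z (coherent_state X))"
proof -
  \<comment> \<open>Complex homogeneity lets the scalar of the shifted state pass through
    \<open>A\<close>.\<close>
  have A: "A (L2_cscale c f) = L2_cscale c (A f)" for c f
    using assms by (simp add: L2_bounded_operator_def)
  have \<sigma>: "symplectic (X + Z) (X - Z) = - 2 * symplectic X Z"
    by (simp add: symplectic_def inner_simps inner_commute)
  have n: "(norm (X + Z - (X - Z)))\<^sup>2 = 4 * (norm Z)\<^sup>2"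
    by (simp add: power2_norm_eq_inner inner_simps inner_commute)
  let ?w = "complex_of_real ((norm Z)\<^sup>2) + \<i> * complex_of_real (symplectic X Z)"
  have inner: "L2_inner (L2_of (coherent_state (X + Z))) (L2_of (coherent_state (X - Z))) = exp (- ?w)"
    unfolding coherent_state_inner \<sigma> n by (simp add: algebra_simps)
  \<comment> \<open>The terms in \<open>X \<bullet> Z\<close> cancel between \<open>s = 1\<close>
    and \<open>s = - 1\<close>, while conjugation makes the two symplectic phases add up; the result
    is the inverse of the overlap.\<close>
  have "exp (complex_of_real (1 * (X \<bullet> Z) + 1\<^sup>2 * (norm Z)\<^sup>2 / 2)
             + \<i> * complex_of_real (1 * symplectic X Z / 2))
      * cnj (exp (complex_of_real (- 1 * (X \<bullet> Z) + (- 1)\<^sup>2 * (norm Z)\<^sup>2 / 2)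
             + \<i> * complex_of_real (- 1 * symplectic X Z / 2))) = exp ?w"
    unfolding exp_cnj exp_add[symmetric] by (simp add: complex_eq_iff)
  moreover have "x / exp (- ?w) = exp ?w * x" for x
    by (simp only: exp_minus divide_inverse inverse_inverse_eq mult.commute)
  ultimately show ?thesis
    unfolding inner exp_Phi_S_coherent_state A L2_inner_cscale by simp
qed

end
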